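(* Let $k\in \mathbb{Z}_{\geq 0}$. Let $b$ be a $k$-generalized Markov number with $b\neq 1$ and $b\neq k+2$. If the number of solutions (modulo $b$) to $x^2+kx+1\equiv 0 \mod b$ is at most two, then there is a unique $k$-generalized Markov triple $(a,b,c)$, up to order, such that $\max\{a,b,c\}=b$.
   Context: For $k\in\mathbb{Z}_{\ge 0}$, the $k$-generalized Markov equation is $x^2+y^2+z^2+k(yz+zx+xy)=(3+3k)xyz$. A $k$-generalized Markov triple is a positive integer solution $(a,b,c)$ of this equation (considered up to order when counting). A $k$-generalized Markov number is a positive integer appearing as an entry of some $k$-generalized Markov triple. *)

theory Defs
  imports Main "HOL-Library.Multiset" "HOL-Number_Theory.Cong"
begin

definition gen_markov_triple :: "nat \<Rightarrow> nat \<Rightarrow> nat \<Rightarrow> nat \<Rightarrow> bool" where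
  "gen_markov_triple k x y z \<longleftrightarrow> 0 < x \<and> 0 < y \<and> 0 < z \<and>
     x\<^sup>2 + y\<^sup>2 + z\<^sup>2 + k * (y * z + z * x + x * y) = (3 + 3 * k) * x * y * z"

definition gen_markov_number :: "nat \<Rightarrow> nat \<Rightarrow> bool" where
  "gen_markov_number k n \<longleftrightarrow>
     (\<exists>x y z. gen_markov_triple k x y z \<and> (n = x \<or> n = y \<or> n = z))"

text \<open>Triples up to order are represented as multisets.\<close>

definition gen_markov_triples :: "nat \<Rightarrow> nat multiset set" where
  "gen_markov_triples k = {{#x, y, z#} | x y z. gen_markov_triple k x y z}"

end

(*
  Attach to a triple (a, c, b) with maximal middle entry c integers p, u, q with
  a u - c p = b and c q - b (u + k) = a.  These relations persist when c is combined with one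
  of its neighbours by a Vieta jump, provided that c enters the left branch as right end with
  value u and the right branch as left end with value u + k.  Hence the fractions u / c, read
  off the tree grown from (1, k + 2, 1), are separated as in the Farey tree, lie strictly
  between 0 and 1, and determine the node.  Since a u = b modulo c, each u is a root of
  x^2 + k x + 1 modulo c.  A triple with maximum c > 1 and its mirror image occupy two distinct
  nodes unless c = k + 2, so two different triples with maximum c give at least three roots.
*)

theory Submission
  imports Defs Complex_Main
begin

section \<open>The equation over the integers\<close>

definition markov_eq :: "int \<Rightarrow> int \<Rightarrow> int \<Rightarrow> int \<Rightarrow> bool" where
  "markov_eq k a b c \<longleftrightarrow> 0 < a \<and> 0 < b \<and> 0 < c \<and>
     a\<^sup>2 + b\<^sup>2 + c\<^sup>2 + k * (b * c + c * a + a * b) = (3 + 3 * k) * a * b * c"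

text \<open>As a quadratic in \<open>c\<close> the equation has a second root; this is that root,
  read off from the sum of the two.\<close>

definition vieta :: "int \<Rightarrow> int \<Rightarrow> int \<Rightarrow> int \<Rightarrow> int" where
  "vieta k a b c = (3 + 3 * k) * a * b - k * (a + b) - c"

lemma gen_markov_triple_iff_markov_eq:
  "gen_markov_triple k x y z \<longleftrightarrow> markov_eq (int k) (int x) (int y) (int z)"
proof -
  have "x\<^sup>2 + y\<^sup>2 + z\<^sup>2 + k * (y * z + z * x + x * y) = (3 + 3 * k) * x * y * z \<longleftrightarrow>
    int (x\<^sup>2 + y\<^sup>2 + z\<^sup>2 + k * (y * z + z * x + x * y)) = int ((3 + 3 * k) * x * y * z)"
    by (simp only: of_nat_eq_iff)
  then show ?thesis
    unfolding gen_markov_triple_def markov_eq_def by simp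
qed

lemma markov_eq_rotate: "markov_eq k a b c \<longleftrightarrow> markov_eq k b c a"
  unfolding markov_eq_def by (auto simp: algebra_simps)

lemma markov_eq_swap: "markov_eq k a b c \<longleftrightarrow> markov_eq k b a c"
  unfolding markov_eq_def by (auto simp: algebra_simps)

section \<open>Vieta jumps and descent to smaller triples\<close>

lemma vieta_mult:
  assumes "markov_eq k a b c"
  shows "c * vieta k a b c = a\<^sup>2 + k * a * b + b\<^sup>2"
  using assms unfolding markov_eq_def vieta_def by (simp add: algebra_simps power2_eq_square)

lemma markov_eq_vieta:
  assumes "markov_eq k a b c" "0 \<le> k"
  shows "markov_eq k a b (vieta k a b c)"
proof -
  have pos: "0 < a" "0 < b" "0 < c" using assms by (auto simp: markov_eq_def)
  have "0 < c * vieta k a b c"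
    unfolding vieta_mult[OF assms(1)] using pos assms(2)
    by (intro add_pos_pos add_pos_nonneg) auto
  then have "0 < vieta k a b c" using pos by (simp add: zero_less_mult_iff)
  moreover have "a\<^sup>2 + b\<^sup>2 + (vieta k a b c)\<^sup>2
      + k * (b * vieta k a b c + vieta k a b c * a + a * b)
      - (3 + 3 * k) * a * b * vieta k a b c
      = a\<^sup>2 + b\<^sup>2 + c\<^sup>2 + k * (b * c + c * a + a * b) - (3 + 3 * k) * a * b * c"
    unfolding vieta_def by algebra
  ultimately show ?thesis
    using assms pos unfolding markov_eq_def by simp
qed

text \<open>The product is the value at \<open>b\<close> of the monic quadratic with roots
  \<open>c\<close> and \<open>vieta k a b c\<close>, so \<open>b\<close> lies weakly between these
  roots. Equation \<open>e\<close> writes the value as the negative of a sum of terms that are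
  nonnegative when 1 \<le> \<open>a\<close> \<le> \<open>b\<close>.\<close>

lemma vieta_at_larger_entry:
  assumes "markov_eq k a b c" "0 \<le> k" "a \<le> b"
  shows "(b - c) * (b - vieta k a b c) \<le> 0"
    and "(b - c) * (b - vieta k a b c) = 0 \<Longrightarrow> a = 1 \<and> b = 1"
proof -
  have pos: "1 \<le> a" "1 \<le> b" using assms by (auto simp: markov_eq_def)
  have e: "(b - c) * (b - vieta k a b c) =
      - (2 * (b\<^sup>2 * (a - 1)) + a * (b\<^sup>2 - a) + k * (b\<^sup>2 * (a - 1) + 2 * (a * b * (b - 1))))"
  proof -
    have "(b - c) * (b - vieta k a b c) = b\<^sup>2 - b * (c + vieta k a b c) + c * vieta k a b c"
      by algebra
    also have "\<dots> = b\<^sup>2 - b * ((3 + 3 * k) * a * b - k * (a + b)) + (a\<^sup>2 + k * a * b + b\<^sup>2)"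
      unfolding vieta_mult[OF assms(1)] by (simp add: vieta_def)
    finally show ?thesis by (simp add: algebra_simps power2_eq_square)
  qed
  have sq: "b \<le> b\<^sup>2" using pos by (simp add: power2_eq_square)
  have n1: "0 \<le> b\<^sup>2 * (a - 1)" using pos by simp
  have n2: "0 \<le> a * (b\<^sup>2 - a)" using pos sq assms(3) by simp
  have n3: "0 \<le> k * (b\<^sup>2 * (a - 1) + 2 * (a * b * (b - 1)))" using pos assms(2) by simp
  show "(b - c) * (b - vieta k a b c) \<le> 0" using e n1 n2 n3 by linarith
  assume "(b - c) * (b - vieta k a b c) = 0"
  then have "b\<^sup>2 * (a - 1) = 0" "a * (b\<^sup>2 - a) = 0" using e n1 n2 n3 by linarith+
  then have "a = 1" "b\<^sup>2 = 1" using pos by auto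
  then show "a = 1 \<and> b = 1" using pos by (auto simp: power2_eq_1_iff)
qed

lemma markov_eq_repeated_max:
  assumes "markov_eq k a b b" "0 \<le> k" "a \<le> b"
  shows "b = 1"
  using vieta_at_larger_entry(2)[OF assms] by simp

lemma vieta_less:
  assumes "markov_eq k a b c" "0 \<le> k" "a \<le> b" "b < c" "b \<noteq> 1"
  shows "vieta k a b c < b"
proof (rule ccontr)
  assume "\<not> ?thesis"
  then have "0 \<le> (b - c) * (b - vieta k a b c)"
    using assms by (intro mult_nonpos_nonpos) auto
  then have "(b - c) * (b - vieta k a b c) = 0"
    using vieta_at_larger_entry(1)[OF assms(1-3)] by linarith
  then show False using vieta_at_larger_entry(2)[OF assms(1-3)] assms by simp
qed

lemma vieta_le:
  assumes "markov_eq k a b c" "0 \<le> k" "a \<le> b" "b < c"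
  shows "vieta k a b c \<le> b"
proof (rule ccontr)
  assume "\<not> ?thesis"
  then have "0 < (b - c) * (b - vieta k a b c)"
    using assms by (intro mult_neg_neg) auto
  then show False using vieta_at_larger_entry(1)[OF assms(1-3)] by linarith
qed

text \<open>If \<open>a\<close> were not 1, jumping at \<open>c\<close> would give a triple whose
  maximum \<open>a\<close> occurs twice, which forces \<open>a = 1\<close>. For \<open>a = 1\<close>
  the quadratic in \<open>c\<close> has the roots 1 and \<open>k + 2\<close>.\<close>

lemma markov_eq_equal_outer:
  assumes "markov_eq k a a c" "0 \<le> k" "a < c"
  shows "a = 1 \<and> c = k + 2"
proof -
  have "a = 1"
  proof (rule ccontr)
    assume "a \<noteq> 1"
    then have "vieta k a a c < a" using vieta_less[of k a a c] assms by simp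
    moreover have "markov_eq k (vieta k a a c) a a"
      using markov_eq_vieta[OF assms(1,2)] markov_eq_rotate by blast
    ultimately show False using markov_eq_repeated_max[of k "vieta k a a c" a] assms \<open>a \<noteq> 1\<close> by simp
  qed
  moreover from this have "(c - 1) * (c - (k + 2)) = 0"
    using assms(1) unfolding markov_eq_def by (simp add: algebra_simps power2_eq_square)
  ultimately show ?thesis using assms by simp
qed

text \<open>A Markov number is given only as some entry of a triple. With \<open>b\<close> kept
  fixed, the larger outer entry is jumped as long as it exceeds \<open>b\<close>; each jump lowers
  the sum of the outer entries.\<close>

lemma ex_triple_with_max:
  assumes "markov_eq k x b z" "0 \<le> k"
  shows "\<exists>a c. markov_eq k a b c \<and> a \<le> b \<and> c \<le> b"
  using assms(1)
proof (induction "nat (x + z)" arbitrary: x z rule: less_induct)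
  case less
  have pos: "0 < x" "0 < b" "0 < z" using less.prems by (auto simp: markov_eq_def)
  \<comment> \<open>The sum \<open>s\<close> and the induction hypothesis are parameters, so that
    this step serves both orders of the outer entries.\<close>
  have jump: ?case if m: "markov_eq k x b z" and le: "x \<le> z" and bz: "b < z"
    and sum: "x + z = s" and IH: "\<And>x' z'. nat (x' + z') < nat s \<Longrightarrow> markov_eq k x' b z' \<Longrightarrow> ?case"
    for x z s
  proof -
    have pos: "0 < x" "0 < b" "0 < z" using m by (auto simp: markov_eq_def)
    have "x \<noteq> z"
    proof
      assume "x = z"
      then have "markov_eq k b z z" using m markov_eq_rotate by blast
      then have "z = 1" using markov_eq_repeated_max assms(2) bz by simp
      then show False using bz pos by simp
    qed
    have "vieta k x b z < z"
    proof (cases "x \<le> b")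
      case True
      then show ?thesis using vieta_le[OF m assms(2)] bz by simp
    next
      case False
      have "markov_eq k b x z" using m markov_eq_swap by blast
      then have "vieta k b x z \<le> x" using vieta_le[of k b x z] assms(2) False le \<open>x \<noteq> z\<close> by simp
      moreover have "vieta k b x z = vieta k x b z" by (simp add: vieta_def algebra_simps)
      ultimately show ?thesis using le \<open>x \<noteq> z\<close> by simp
    qed
    then have "nat (x + vieta k x b z) < nat s" using sum pos by simp
    then show ?thesis using IH markov_eq_vieta[OF m assms(2)] by blast
  qed
  show ?case
  proof (cases "x \<le> b \<and> z \<le> b")
    case True
    then show ?thesis using less.prems by blast
  next
    case False
    show ?thesis
    proof (cases "x \<le> z")
      case True
      with False have "b < z" by auto
      show ?thesis
        by (rule jump[OF less.prems True \<open>b < z\<close> refl]) (use less.hyps in blast)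
    next
      case f2: False
      with False have "b < x" by auto
      have m: "markov_eq k z b x" using less.prems markov_eq_rotate markov_eq_swap by blast
      show ?thesis
        by (rule jump[OF m _ \<open>b < x\<close>, of "x + z"]) (use f2 less.hyps in auto)
    qed
  qed
qed

section \<open>The tree of triples and characteristic numbers\<close>

text \<open>The middle entry carries the pair of values \<open>mchar\<close> and \<open>mchar + k\<close>; the outer entries carry
  the one value that faces the middle.\<close>

datatype node = Node (left: int) (middle: int) (right: int) (lchar: int) (mchar: int) (rchar: int)

fun well_formed :: "int \<Rightarrow> node \<Rightarrow> bool" where
  "well_formed k (Node a c b p u q) \<longleftrightarrow> markov_eq k a c b \<and>
     coprime a c \<and> coprime c b \<and> coprime a b \<and>
     a * u - c * p = b \<and> c * q - b * (u + k) = a"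

text \<open>The new middle value is forced by the first relation of \<open>well_formed\<close>: on
  the left, a new middle \<open>d\<close> with value \<open>v\<close> must satisfy
  \<open>a * v - d * p = c\<close>.\<close>

fun child :: "int \<Rightarrow> bool \<Rightarrow> node \<Rightarrow> node" where
  "child k False (Node a c b p u q) =
     Node a (vieta k a c b) c p (((3 + 3 * k) * a - k) * u - q - k * (p + 1)) u"
| "child k True (Node a c b p u q) =
     Node c (vieta k c b a) b (u + k) (((3 + 3 * k) * b - k) * (u + k) - p - k * q) q"

definition root :: "int \<Rightarrow> node" where
  "root k = Node 1 (k + 2) 1 0 1 1"

text \<open>Reflection that negates all fractions and so exchanges left and right. The mirror image
  of a descendant of \<open>root\<close> has a negative middle value and leaves the tree; the
  reflection serves to carry invariance from the left branch over to the right.\<close>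

fun mirror :: "int \<Rightarrow> node \<Rightarrow> node" where
  "mirror k (Node a c b p u q) = Node b c a (- q) (- u - k) (- p)"

lemma child_True_eq_mirror: "child k True s = mirror k (child k False (mirror k s))"
  by (cases s) (simp add: vieta_def algebra_simps)

lemma well_formed_mirror:
  assumes "well_formed k s" shows "well_formed k (mirror k s)"
proof (cases s)
  case (Node a c b p u q)
  have "markov_eq k b c a \<longleftrightarrow> markov_eq k a c b" using markov_eq_rotate markov_eq_swap by blast
  then show ?thesis using assms Node by (auto simp: coprime_commute algebra_simps)
qed

lemma well_formed_child_False:
  assumes "well_formed k s" "0 \<le> k" shows "well_formed k (child k False s)"
proof (cases s)
  case (Node a c b p u q)
  define d where "d = vieta k a c b"
  define e where "e = vieta k a b c"
  define v where "v = ((3 + 3 * k) * a - k) * u - q - k * (p + 1)"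
  have m: "markov_eq k a c b" and co: "coprime a c" 
    and r1: "a * u - c * p = b" and r2: "c * q - b * (u + k) = a"
    using assms Node by auto
  have pos: "0 < a" "0 < b" "0 < c" using m by (auto simp: markov_eq_def)
  have md: "markov_eq k a c d" using markov_eq_vieta[OF m assms(2)] by (simp add: d_def)
  have bd: "b * d = a\<^sup>2 + k * a * c + c\<^sup>2" using vieta_mult[OF m] by (simp add: d_def)
  have m': "markov_eq k a b c" using m markov_eq_rotate markov_eq_swap by blast
  \<comment> \<open>Eliminating \<open>u\<close> from the two relations gives a third one between
    the outer values; its right side is the Vieta partner of \<open>c\<close>.\<close>
  have "c * (a * q - b * p) = a * (c * q) - b * (c * p)" by algebra
  also have "\<dots> = a * (a + b * (u + k)) - b * (a * u - b)"
  proof -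
    have "c * q = a + b * (u + k)" "c * p = a * u - b" using r1 r2 by linarith+
    then show ?thesis by (simp only:)
  qed
  also have "\<dots> = c * e" unfolding e_def vieta_mult[OF m']
    by (simp add: algebra_simps power2_eq_square)
  finally have r3: "a * q - b * p = e" using pos by simp
  have dd: "d = ((3 + 3 * k) * a - k) * c - k * a - b" by (simp add: d_def vieta_def algebra_simps)
  have ee: "e = ((3 + 3 * k) * a - k) * b - k * a - c" by (simp add: e_def vieta_def algebra_simps)
  have "a * v - d * p = ((3 + 3 * k) * a - k) * (a * u - c * p) - (a * q - b * p) - k * a"
    unfolding v_def dd by algebra
  then have n1: "a * v - d * p = c" unfolding r1 r3 ee by simp
  have "d * u - c * (v + k) = (c * q - b * u) - k * (a * u - c * p)"
    unfolding v_def dd by algebra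
  then have n2: "d * u - c * (v + k) = a" unfolding r1 using r2 by (simp add: algebra_simps)
  \<comment> \<open>The product \<open>b * d\<close> is \<open>c\<close> squared modulo
    \<open>a\<close> and \<open>a\<close> squared modulo \<open>c\<close>, so the new entry
    \<open>d\<close> is coprime to both.\<close>
  have "coprime a (b * d)"
  proof -
    have "b * d = c\<^sup>2 + a * (a + k * c)" unfolding bd by (simp add: algebra_simps power2_eq_square)
    moreover have "coprime a (c\<^sup>2)" using co by simp
    ultimately show ?thesis by (metis coprime_iff_gcd_eq_1 gcd_add_mult mult.commute add.commute)
  qed
  moreover have "coprime c (b * d)"
  proof -
    have "b * d = a\<^sup>2 + c * (c + k * a)" unfolding bd by (simp add: algebra_simps power2_eq_square)
    moreover have "coprime c (a\<^sup>2)" using co by (simp add: coprime_commute)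
    ultimately show ?thesis by (metis coprime_iff_gcd_eq_1 gcd_add_mult mult.commute add.commute)
  qed
  ultimately have "coprime a d" "coprime d c" by (auto simp: coprime_commute)
  moreover have "markov_eq k a d c" using md markov_eq_rotate markov_eq_swap by blast
  ultimately show ?thesis using Node n1 n2 co by (simp add: d_def v_def)
qed

lemma well_formed_child:
  assumes "well_formed k s" "0 \<le> k" shows "well_formed k (child k d s)"
proof (cases d)
  case True
  then show ?thesis
    using assms by (simp only: child_True_eq_mirror well_formed_mirror well_formed_child_False)
next
  case False
  then show ?thesis using assms by (simp add: well_formed_child_False)
qed

lemma well_formed_descendant:
  assumes "well_formed k s" "0 \<le> k" shows "well_formed k (fold (child k) ds s)"
  using assms by (induction ds arbitrary: s) (auto simp: well_formed_child)

lemma well_formed_root: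
  assumes "0 \<le> k" shows "well_formed k (root k)"
  using assms by (simp add: root_def markov_eq_def algebra_simps power2_eq_square)

section \<open>Separation of the characteristic fractions\<close>

abbreviation lfrac :: "node \<Rightarrow> real" where
  "lfrac s \<equiv> of_int (lchar s) / of_int (left s)"

abbreviation mfrac :: "node \<Rightarrow> real" where
  "mfrac s \<equiv> of_int (mchar s) / of_int (middle s)"

abbreviation rfrac :: "node \<Rightarrow> real" where
  "rfrac s \<equiv> of_int (rchar s) / of_int (right s)"

abbreviation mfrac' :: "int \<Rightarrow> node \<Rightarrow> real" where
  "mfrac' k s \<equiv> of_int (mchar s + k) / of_int (middle s)"

text \<open>After clearing denominators, the strict inequalities are the two relations of
  \<open>well_formed\<close> with their positive right sides; the middle gap is
  \<open>k / c\<close>.\<close>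

lemma fractions_ordered:
  assumes "well_formed k s" "0 \<le> k"
  shows "lfrac s < mfrac s" "mfrac s \<le> mfrac' k s" "mfrac' k s < rfrac s"
proof -
  obtain a c b p u q where s: "s = Node a c b p u q" by (cases s)
  have pos: "0 < a" "0 < b" "0 < c"
    and r: "c * p < a * u" "b * (u + k) < c * q"
    using assms s by (auto simp: markov_eq_def)
  show "lfrac s < mfrac s"
  proof -
    have "of_int (c * p) < (of_int (a * u) :: real)" using r by (simp only: of_int_less_iff)
    then show ?thesis using s pos by (simp add: field_simps)
  qed
  show "mfrac s \<le> mfrac' k s" using s pos assms(2) by (simp add: divide_right_mono)
  show "mfrac' k s < rfrac s"
  proof -
    have "of_int (b * (u + k)) < (of_int (c * q) :: real)" using r by (simp only: of_int_less_iff)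
    then show ?thesis using s pos by (simp add: field_simps)
  qed
qed

lemma child_fractions:
  "lfrac (child k False s) = lfrac s" "rfrac (child k False s) = mfrac s"
  "lfrac (child k True s) = mfrac' k s" "rfrac (child k True s) = rfrac s"
  by (cases s; simp)+

text \<open>Passing to a child shrinks the interval from \<open>lfrac\<close> to
  \<open>rfrac\<close>, so the bounds survive along every path.\<close>

lemma descendant_fractions:
  assumes "well_formed k s" "0 \<le> k"
  shows "lfrac s < mfrac (fold (child k) ds s) \<and> mfrac' k (fold (child k) ds s) < rfrac s"
  using assms(1)
proof (induction ds arbitrary: s)
  case Nil
  then show ?case using fractions_ordered[OF _ assms(2)] by simp
next
  case (Cons d ds)
  have "lfrac s \<le> lfrac (child k d s)" "rfrac (child k d s) \<le> rfrac s"
    using fractions_ordered[OF Cons.prems assms(2)] by (cases d; simp only: child_fractions; linarith)+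
  moreover have "well_formed k (child k d s)" using well_formed_child Cons.prems assms(2) by blast
  ultimately show ?case using Cons.IH[of "child k d s"] by (simp del: of_int_add)
qed

text \<open>The search tree property: the interval of the left child ends at \<open>mfrac s\<close>,
  that of the right child starts at \<open>mfrac' k s\<close>, and descendants stay strictly
  inside.\<close>

lemma descendant_side:
  assumes "well_formed k s" "0 \<le> k"
  shows "mfrac (fold (child k) ds (child k False s)) < mfrac s"
    and "mfrac s < mfrac (fold (child k) ds (child k True s))"
proof -
  have wf: "well_formed k (fold (child k) ds (child k False s))"
    using well_formed_descendant well_formed_child assms by blast
  show "mfrac (fold (child k) ds (child k False s)) < mfrac s"
    using descendant_fractions[OF well_formed_child[OF assms, of False] assms(2), of ds]
      fractions_ordered(2)[OF wf assms(2)] unfolding child_fractions by linarith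
  show "mfrac s < mfrac (fold (child k) ds (child k True s))"
    using descendant_fractions[OF well_formed_child[OF assms, of True] assms(2), of ds]
      fractions_ordered(2)[OF assms] unfolding child_fractions by linarith
qed

text \<open>Where two paths first part, or where one of them stops, \<open>descendant_side\<close>
  separates their fractions strictly.\<close>

lemma path_determined_by_fraction:
  assumes "well_formed k s" "0 \<le> k"
    and "mfrac (fold (child k) ds s) = mfrac (fold (child k) es s)"
  shows "ds = es"
  using assms(1,3)
proof (induction ds arbitrary: s es)
  case Nil
  show ?case
  proof (cases es)
    case (Cons e es')
    then show ?thesis using descendant_side[OF Nil(1) assms(2), of es'] Nil(2) by (cases e) auto
  qed simp
next
  case (Cons d ds)
  note side = descendant_side[OF Cons.prems(1) assms(2)]
  show ?case
  proof (cases es)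
    case Nil
    then show ?thesis using side[of ds] Cons.prems(2) by (cases d) auto
  next
    case es: (Cons e es')
    have "d = e"
      using side[of ds] side[of es'] Cons.prems(2) unfolding es
      by (cases d; cases e) auto
    then show ?thesis
      using Cons.IH[of "child k d s" es'] Cons.prems well_formed_child[OF _ assms(2)] es by simp
  qed
qed

section \<open>Completeness of the tree\<close>

lemma ex_path_to_triple:
  assumes "markov_eq k a c b" "0 \<le> k" "a < c" "b < c"
  shows "\<exists>ds p u q. fold (child k) ds (root k) = Node a c b p u q"
  using assms(1,3,4)
proof (induction "nat c" arbitrary: a b c rule: less_induct)
  case less
  have pos: "0 < a" "0 < b" "0 < c" using less.prems by (auto simp: markov_eq_def)
  have mab: "markov_eq k a b c" and mba: "markov_eq k b a c"
    using less.prems markov_eq_rotate markov_eq_swap by blast+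
  have invol: "vieta k x y (vieta k x y z) = z" for x y z by (simp add: vieta_def)
  have comm: "vieta k x y z = vieta k y x z" for x y z by (simp add: vieta_def algebra_simps)
  have pv: "0 < vieta k a b c" using markov_eq_vieta[OF mab assms(2)] by (simp add: markov_eq_def)
  \<comment> \<open>Jumping at the maximum \<open>c\<close> yields the parent, whose middle is the
    larger outer entry. If that entry is \<open>b\<close>, the node is a left child; if it is
    \<open>a\<close>, a right child. Equal outer entries occur only at the root.\<close>
  consider "a < b" | "b < a" | "a = b" by linarith
  then show ?case
  proof cases
    case 1
    then have "vieta k a b c < b" using vieta_less[OF mab assms(2)] less.prems pos by simp
    then obtain ds p u q where "fold (child k) ds (root k) = Node a b (vieta k a b c) p u q"
      using less.hyps[of b a "vieta k a b c"] 1 less.prems markov_eq_vieta[OF mab assms(2)] pos by auto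
    then have "\<exists>p u q. fold (child k) (ds @ [False]) (root k) = Node a c b p u q"
      by (simp add: invol)
    then show ?thesis by blast
  next
    case 2
    then have "vieta k a b c < a"
      using vieta_less[OF mba assms(2)] less.prems pos comm[of a b c] by simp
    moreover have "markov_eq k (vieta k a b c) a b"
      using markov_eq_vieta[OF mab assms(2)] markov_eq_rotate by blast
    ultimately obtain ds p u q where "fold (child k) ds (root k) = Node (vieta k a b c) a b p u q"
      using less.hyps[of a "vieta k a b c" b] 2 less.prems pos by auto
    then have "\<exists>p u q. fold (child k) (ds @ [True]) (root k) = Node a c b p u q"
      by (simp add: invol)
    then show ?thesis by blast
  next
    case 3
    then have "a = 1" "c = k + 2" using markov_eq_equal_outer mab assms(2) less.prems by auto
    then have "fold (child k) [] (root k) = Node a c b 0 1 1" using 3 by (simp add: root_def)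
    then show ?thesis by blast
  qed
qed

section \<open>Roots of the congruence\<close>

lemma mchar_root_of_congruence:
  assumes "well_formed k (Node a c b p u q)"
  shows "c dvd u\<^sup>2 + k * u + 1"
proof -
  have "markov_eq k a c b" and r: "b = a * u - c * p" and co: "coprime a c"
    using assms by simp_all
  then have m: "markov_eq k a b c" using markov_eq_rotate markov_eq_swap by blast
  \<comment> \<open>Since \<open>a * u\<close> is \<open>b\<close> modulo \<open>c\<close>, this
    product is congruent to \<open>a\<^sup>2 + k * a * b + b\<^sup>2\<close>, a multiple of
    \<open>c\<close> by \<open>vieta_mult\<close>. Coprimality then cancels
    \<open>a\<^sup>2\<close>.\<close>
  have "a\<^sup>2 * (u\<^sup>2 + k * u + 1)
      = (a\<^sup>2 + k * a * b + b\<^sup>2) + c * (p * (k * a + 2 * a * u - c * p))"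
    unfolding r by algebra
  also have "\<dots> = c * (vieta k a b c + p * (k * a + 2 * a * u - c * p))"
    unfolding vieta_mult[OF m, symmetric] by algebra
  finally have "c dvd a\<^sup>2 * (u\<^sup>2 + k * u + 1)" by simp
  moreover have "coprime c (a\<^sup>2)" using co by (simp add: coprime_commute)
  ultimately show ?thesis by (simp add: coprime_dvd_mult_right_iff)
qed

definition markov_path :: "int \<Rightarrow> int \<Rightarrow> int \<Rightarrow> int \<Rightarrow> bool list \<Rightarrow> bool" where
  "markov_path k a c b ds \<longleftrightarrow> (\<exists>p u q. fold (child k) ds (root k) = Node a c b p u q)"

definition path_char :: "int \<Rightarrow> bool list \<Rightarrow> int" where
  "path_char k ds = mchar (fold (child k) ds (root k))"

text \<open>Nonnegativity is recorded so that \<open>nat\<close> stays injective on the values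
  compared later.\<close>

lemma path_char_solution:
  assumes "markov_path (int k) a (int c) b ds"
  shows "0 \<le> path_char (int k) ds"
    and "nat (path_char (int k) ds) \<in> {x \<in> {0..<c}. [x\<^sup>2 + k * x + 1 = 0] (mod c)}"
proof -
  obtain p u q where n: "fold (child (int k)) ds (root (int k)) = Node a (int c) b p u q"
    using assms by (auto simp: markov_path_def)
  note wr = well_formed_root[of "int k", simplified]
  have wf: "well_formed (int k) (Node a (int c) b p u q)"
    using well_formed_descendant[OF wr, of ds] n by simp
  then have pos: "0 < c" by (simp add: markov_eq_def)
  have u: "path_char (int k) ds = u" by (simp add: path_char_def n)
  \<comment> \<open>The outer fractions of the root are 0 and 1, so \<open>u\<close> is its own
    residue modulo \<open>c\<close>.\<close>
  have bd: "0 < (of_int u :: real) / of_int (int c)" "of_int (u + int k) / of_int (int c) < (1::real)"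
    using descendant_fractions[OF wr, of ds] unfolding n by (auto simp: root_def)
  then have "0 < (of_int u :: real)" "of_int (u + int k) < (of_int (int c) :: real)"
    using pos by (auto simp: field_simps)
  then have u0: "0 < u" and uc: "u + int k < int c" by linarith+
  show "0 \<le> path_char (int k) ds" using u u0 by simp
  have "int c dvd u\<^sup>2 + int k * u + 1" by (rule mchar_root_of_congruence[OF wf])
  also have "u\<^sup>2 + int k * u + 1 = int ((nat u)\<^sup>2 + k * nat u + 1)" using u0 by simp
  finally have "c dvd (nat u)\<^sup>2 + k * nat u + 1" by (simp only: of_nat_dvd_iff)
  then show "nat (path_char (int k) ds) \<in> {x \<in> {0..<c}. [x\<^sup>2 + k * x + 1 = 0] (mod c)}"
    using u u0 uc by (simp add: cong_0_iff nat_less_iff)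
qed

text \<open>With the common middle \<open>c\<close>, equal values give equal fractions and hence the
  same path.\<close>

lemma path_char_inj:
  assumes "markov_path k a c b ds" "markov_path k a' c b' es" "0 \<le> k"
    and "path_char k ds = path_char k es"
  shows "a = a' \<and> b = b'"
proof -
  have "mfrac (fold (child k) ds (root k)) = mfrac (fold (child k) es (root k))"
    using assms by (auto simp: markov_path_def path_char_def)
  then have "ds = es"
    using path_determined_by_fraction[OF well_formed_root] assms(3) by blast
  then show ?thesis using assms by (auto simp: markov_path_def)
qed

section \<open>Uniqueness\<close>

lemma triple_with_max_middle:
  assumes "T \<in> gen_markov_triples k" "Max (set_mset T) = b"
  obtains a c where "T = {#a, b, c#}" "gen_markov_triple k a b c" "a \<le> b" "c \<le> b"
proof -
  obtain x y z where T: "T = {#x, y, z#}" and g: "gen_markov_triple k x y z"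
    using assms(1) by (auto simp: gen_markov_triples_def)
  have perm: "gen_markov_triple k y x z" "gen_markov_triple k x z y"
    using g markov_eq_rotate markov_eq_swap unfolding gen_markov_triple_iff_markov_eq by blast+
  have b: "b \<in> set_mset T" "\<And>w. w \<in> set_mset T \<Longrightarrow> w \<le> b"
    using assms(2) Max_in[of "set_mset T"] Max_ge[of "set_mset T"] T by auto
  then consider "b = x" | "b = y" | "b = z" using T by auto
  then show ?thesis
  proof cases
    case 1
    show ?thesis by (rule that[of y z]) (use 1 T g perm b in \<open>auto simp: add_mset_commute\<close>)
  next
    case 2
    show ?thesis by (rule that[of x z]) (use 2 T g perm b in auto)
  next
    case 3
    show ?thesis by (rule that[of x y]) (use 3 T g perm b in \<open>auto simp: add_mset_commute\<close>)
  qed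
qed

text \<open>The condition \<open>b \<noteq> 1\<close> excludes a repeated maximum, so both orders of
  the outer entries occur in the tree; \<open>b \<noteq> k + 2\<close> excludes equal outer entries,
  so these are two different nodes.\<close>

lemma paths_of_triple:
  assumes "gen_markov_triple k a b c" "a \<le> b" "c \<le> b" "b \<noteq> 1" "b \<noteq> k + 2"
  obtains ds es where "markov_path (int k) (int a) (int b) (int c) ds"
    "markov_path (int k) (int c) (int b) (int a) es" "a \<noteq> c"
proof -
  have m: "markov_eq (int k) (int a) (int b) (int c)"
    using assms by (simp add: gen_markov_triple_iff_markov_eq)
  then have m': "markov_eq (int k) (int c) (int b) (int a)"
    "markov_eq (int k) (int c) (int a) (int b)" "markov_eq (int k) (int a) (int c) (int b)"
    using markov_eq_rotate markov_eq_swap by blast+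
  have ne: "a \<noteq> b" "c \<noteq> b"
    using markov_eq_repeated_max[of "int k" "int c" "int b"]
      markov_eq_repeated_max[of "int k" "int a" "int b"] m m' assms by auto
  have "a \<noteq> c"
    using markov_eq_equal_outer[of "int k" "int a" "int b"] m' assms ne by auto
  then show ?thesis
    using ex_path_to_triple[OF m] ex_path_to_triple[OF m'(1)] ne assms that
    unfolding markov_path_def by (simp, blast)
qed

theorem theorem1p5:
  fixes k b :: nat
  assumes "gen_markov_number k b"
    and "b \<noteq> 1"
    and "b \<noteq> k + 2"
    and "card {x \<in> {0..<b}. [x\<^sup>2 + k * x + 1 = 0] (mod b)} \<le> 2"
  shows "\<exists>!T. T \<in> gen_markov_triples k \<and> Max (set_mset T) = b"
proof (rule ex_ex1I)
  obtain x z where "markov_eq (int k) (int x) (int b) (int z)"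
    using assms(1) markov_eq_rotate markov_eq_swap
    unfolding gen_markov_number_def gen_markov_triple_iff_markov_eq by metis
  \<comment> \<open>The triple witnessing that \<open>b\<close> is a Markov number may have larger
    entries; descent makes \<open>b\<close> the maximum.\<close>
  then obtain a c where ac: "markov_eq (int k) a (int b) c" "a \<le> int b" "c \<le> int b"
    using ex_triple_with_max by fastforce
  moreover from ac have "0 < a" "0 < c" by (auto simp: markov_eq_def)
  ultimately have "gen_markov_triple k (nat a) b (nat c)" "nat a \<le> b" "nat c \<le> b"
    by (auto simp: gen_markov_triple_iff_markov_eq)
  then show "\<exists>T. T \<in> gen_markov_triples k \<and> Max (set_mset T) = b"
    by (intro exI[of _ "{#nat a, b, nat c#}"]) (auto simp: gen_markov_triples_def)
next
  fix T T'
  assume T: "T \<in> gen_markov_triples k \<and> Max (set_mset T) = b"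
    and T': "T' \<in> gen_markov_triples k \<and> Max (set_mset T') = b"
  define S where "S = {x \<in> {0..<b}. [x\<^sup>2 + k * x + 1 = 0] (mod b)}"
  obtain a c where ac: "T = {#a, b, c#}" "gen_markov_triple k a b c" "a \<le> b" "c \<le> b"
    using triple_with_max_middle T by metis
  obtain a' c' where ac': "T' = {#a', b, c'#}" "gen_markov_triple k a' b c'" "a' \<le> b" "c' \<le> b"
    using triple_with_max_middle T' by metis
  obtain ds es where ds: "markov_path (int k) (int a) (int b) (int c) ds"
    and es: "markov_path (int k) (int c) (int b) (int a) es" and "a \<noteq> c"
    using paths_of_triple[OF ac(2-4) assms(2,3)] by metis
  obtain fs where fs: "markov_path (int k) (int a') (int b) (int c') fs"
    using paths_of_triple[OF ac'(2-4) assms(2,3)] by metis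
  show "T = T'"
  proof (rule ccontr)
    assume "T \<noteq> T'"
    \<comment> \<open>As multisets ignore order, \<open>(a', c')\<close> differs from both
      \<open>(a, c)\<close> and \<open>(c, a)\<close>; this gives three nodes with middle
      \<open>b\<close> and so three distinct roots.\<close>
    then have ne: "\<not> (a = a' \<and> c = c')" "\<not> (c = a' \<and> a = c')"
      using ac(1) ac'(1) by (auto simp: add_mset_commute)
    let ?f = "\<lambda>ds. nat (path_char (int k) ds)"
    have "?f ds \<noteq> ?f es"
      using path_char_inj[OF ds es of_nat_0_le_iff] path_char_solution(1)[OF ds] path_char_solution(1)[OF es]
        \<open>a \<noteq> c\<close> by (auto simp: eq_nat_nat_iff)
    moreover have "?f ds \<noteq> ?f fs"
      using path_char_inj[OF ds fs of_nat_0_le_iff] path_char_solution(1)[OF ds] path_char_solution(1)[OF fs]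
        ne(1) by (auto simp: eq_nat_nat_iff)
    moreover have "?f es \<noteq> ?f fs"
      using path_char_inj[OF es fs of_nat_0_le_iff] path_char_solution(1)[OF es] path_char_solution(1)[OF fs]
        ne(2) by (auto simp: eq_nat_nat_iff)
    ultimately have "card {?f ds, ?f es, ?f fs} = 3" by simp
    moreover have "{?f ds, ?f es, ?f fs} \<subseteq> S"
      unfolding S_def
      using path_char_solution(2)[OF ds] path_char_solution(2)[OF es] path_char_solution(2)[OF fs]
      by blast
    moreover have "finite S" by (simp add: S_def)
    ultimately have "3 \<le> card S" by (metis card_mono)
    then show False using assms(4) by (simp add: S_def)
  qed
qed

end
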